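(* Let $E$ be a locally convex space and let $X\subset E$ be a weakly bounded subset. Then the barycenter map $b_X:\hat P(X)\to E^{**}$, $b_X(\mu)(f)=\int_X f\,d\mu$ for $f\in E^*$, is continuous if and only if the set $X$ is bounded in $E$.
   Context: Locally convex spaces are real and Hausdorff. For a Tychonoff space $X$, $\hat P(X)$ is the set of all Radon probability measures on $X$ (Borel probability measures $\mu$ with $\mu(B)=\sup\{\mu(K):K\subset B \text{ compact}\}$ for all Borel $B\subset X$), with the weakest topology making all maps $\mu\mapsto\int_X f\,d\mu$, $f:X\to\mathbb R$ bounded continuous, continuous. For a locally convex space $E$, $E^*$ is the space of continuous linear functionals on $E$, with the topology of uniform convergence on weakly bounded subsets of $E$; $A\subset E$ is weakly bounded if every $f\in E^*$ is bounded on $A$. A subset $A\subset E$ is bounded if it is absorbed by every neighborhood of zero. A set $\mathcal K\subset E^*$ is equicontinuous if there is a neighborhood $U\subset E$ of zero with $|f(x)|<1$ for all $x\in U$, $f\in\mathcal K$. $E^{**}$ is the space of continuous linear functionals on $E^*$, with the topology of uniform convergence on equicontinuous subsets of $E^*$. For weakly bounded $X$ the functional $b_X(\mu)$ is continuous on $E^*$, so $b_X$ is well defined. *)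

theory Defs
  imports "HOL-Analysis.Analysis" "HOL-Probability.Probability"
begin

class locally_convex_space = real_vector + topological_ab_group_add + t2_space +
  assumes tendsto_scaleR_Pair:
    "LIM p (nhds r \<times>\<^sub>F nhds x). fst p *\<^sub>R snd p :> nhds (r *\<^sub>R x)"
  assumes convex_neighborhood_base':
    "\<lbrakk>open U; 0 \<in> U\<rbrakk> \<Longrightarrow>
      \<exists>V. (\<forall>x\<in>V. \<forall>y\<in>V. \<forall>u\<ge>0. \<forall>v\<ge>0. u + v = 1 \<longrightarrow> u *\<^sub>R x + v *\<^sub>R y \<in> V) \<and>
          open V \<and> 0 \<in> V \<and> V \<subseteq> U"

text \<open>A class assumption cannot mention \<^const>\<open>convex\<close>, hence this restatement.\<close>

lemma convex_neighborhood_base: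
  fixes U :: "'a::locally_convex_space set"
  assumes "open U" "0 \<in> U"
  shows "\<exists>V. convex V \<and> open V \<and> 0 \<in> V \<and> V \<subseteq> U"
  using convex_neighborhood_base'[OF assms] unfolding convex_def .

text \<open>The library predicate \<^const>\<open>bounded\<close> refers to a metric, so boundedness in the sense of
  topological vector spaces is defined here: every neighborhood of zero absorbs the set.\<close>

definition absorbs :: "'a::real_vector set \<Rightarrow> 'a set \<Rightarrow> bool" where
  "absorbs U A \<longleftrightarrow> (\<exists>r>0. \<forall>t. r \<le> \<bar>t\<bar> \<longrightarrow> A \<subseteq> (\<lambda>x. t *\<^sub>R x) ` U)"

definition tvs_bounded :: "'a::locally_convex_space set \<Rightarrow> bool" where
  "tvs_bounded A \<longleftrightarrow> (\<forall>U. 0 \<in> interior U \<longrightarrow> absorbs U A)"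

text \<open>The topology on a set \<open>F\<close> of real-valued functions of uniform convergence on the members
  of a family \<open>\<A>\<close>. Finite unions of members are used, so \<open>\<A>\<close> need not be directed.\<close>

definition uniform_nbhd ::
    "('x \<Rightarrow> real) set \<Rightarrow> ('x \<Rightarrow> real) \<Rightarrow> 'x set \<Rightarrow> real \<Rightarrow> ('x \<Rightarrow> real) set" where
  "uniform_nbhd F f A e = {g \<in> F. \<forall>x\<in>A. \<bar>g x - f x\<bar> < e}"

definition uniform_topology :: "('x \<Rightarrow> real) set \<Rightarrow> 'x set set \<Rightarrow> ('x \<Rightarrow> real) topology" where
  "uniform_topology F \<A> = topology (\<lambda>U. U \<subseteq> F \<and>
     (\<forall>f\<in>U. \<exists>\<B> e. finite \<B> \<and> \<B> \<subseteq> \<A> \<and> 0 < e \<and> uniform_nbhd F f (\<Union>\<B>) e \<subseteq> U))"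

lemma openin_uniform_topology:
  "openin (uniform_topology F \<A>) U \<longleftrightarrow> U \<subseteq> F \<and>
     (\<forall>f\<in>U. \<exists>\<B> e. finite \<B> \<and> \<B> \<subseteq> \<A> \<and> 0 < e \<and> uniform_nbhd F f (\<Union>\<B>) e \<subseteq> U)"
    (is "_ \<longleftrightarrow> ?P U")
proof -
  have "istopology ?P"
  proof -
    have 1: "?P (S \<inter> T)" if S: "?P S" and T: "?P T" for S T
    proof (intro conjI ballI)
      show "S \<inter> T \<subseteq> F" using S by blast
      fix f assume f: "f \<in> S \<inter> T"
      obtain \<B> d where B: "finite \<B>" "\<B> \<subseteq> \<A>" "0 < d" "uniform_nbhd F f (\<Union>\<B>) d \<subseteq> S"
        using S f by blast
      obtain \<C> e where C: "finite \<C>" "\<C> \<subseteq> \<A>" "0 < e" "uniform_nbhd F f (\<Union>\<C>) e \<subseteq> T"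
        using T f by blast
      have "uniform_nbhd F f (\<Union>(\<B> \<union> \<C>)) (min d e) \<subseteq>
              uniform_nbhd F f (\<Union>\<B>) d \<inter> uniform_nbhd F f (\<Union>\<C>) e"
        unfolding uniform_nbhd_def by auto
      with B C have "finite (\<B> \<union> \<C>) \<and> \<B> \<union> \<C> \<subseteq> \<A> \<and> 0 < min d e \<and>
          uniform_nbhd F f (\<Union>(\<B> \<union> \<C>)) (min d e) \<subseteq> S \<inter> T"
        by auto
      then show "\<exists>\<B> e. finite \<B> \<and> \<B> \<subseteq> \<A> \<and> 0 < e \<and> uniform_nbhd F f (\<Union>\<B>) e \<subseteq> S \<inter> T"
        by blast
    qed
    have 2: "?P (\<Union>\<K>)" if K: "\<forall>S\<in>\<K>. ?P S" for \<K>
    proof (intro conjI ballI)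
      show "\<Union>\<K> \<subseteq> F" using K by blast
      fix f assume "f \<in> \<Union>\<K>"
      then obtain S where S: "S \<in> \<K>" "f \<in> S" by blast
      then have "\<exists>\<B> e. finite \<B> \<and> \<B> \<subseteq> \<A> \<and> 0 < e \<and> uniform_nbhd F f (\<Union>\<B>) e \<subseteq> S"
        using K by simp
      then obtain \<B> e where B: "finite \<B>" "\<B> \<subseteq> \<A>" "0 < e" "uniform_nbhd F f (\<Union>\<B>) e \<subseteq> S"
        by (elim exE conjE)
      have "uniform_nbhd F f (\<Union>\<B>) e \<subseteq> \<Union>\<K>"
        using B(4) S(1) by (rule subset_trans[OF _ Union_upper])
      with B(1-3) show "\<exists>\<B> e. finite \<B> \<and> \<B> \<subseteq> \<A> \<and> 0 < e \<and> uniform_nbhd F f (\<Union>\<B>) e \<subseteq> \<Union>\<K>"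
        by blast
    qed
    show ?thesis
      unfolding istopology_def
      by (rule conjI; intro allI impI; (rule 1 | rule 2); assumption)
  qed
  then show ?thesis
    unfolding uniform_topology_def by (simp add: topology_inverse')
qed

lemma topspace_uniform_topology [simp]: "topspace (uniform_topology F \<A>) = F"
proof
  show "topspace (uniform_topology F \<A>) \<subseteq> F"
    using openin_topspace[of "uniform_topology F \<A>"] openin_uniform_topology[of F \<A>] by blast
  have "openin (uniform_topology F \<A>) F"
    unfolding openin_uniform_topology uniform_nbhd_def
    by (auto intro!: exI[of _ "{}"] exI[of _ "1::real"])
  then show "F \<subseteq> topspace (uniform_topology F \<A>)" by (rule openin_subset)
qed

definition dual :: "('a::locally_convex_space \<Rightarrow> real) set" where
  "dual = {f. linear f \<and> continuous_on UNIV f}"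

definition weakly_bounded :: "'a::locally_convex_space set \<Rightarrow> bool" where
  "weakly_bounded A \<longleftrightarrow> (\<forall>f\<in>dual. bounded (f ` A))"

definition dual_topology :: "('a::locally_convex_space \<Rightarrow> real) topology" where
  "dual_topology = uniform_topology dual {A. weakly_bounded A}"

definition equicontinuous :: "('a::locally_convex_space \<Rightarrow> real) set \<Rightarrow> bool" where
  "equicontinuous K \<longleftrightarrow> K \<subseteq> dual \<and> (\<exists>U. 0 \<in> interior U \<and> (\<forall>x\<in>U. \<forall>f\<in>K. \<bar>f x\<bar> < 1))"

text \<open>The dual is a set rather than a type, so linearity of functionals on it is spelled out for
  the pointwise operations. Functionals are made \<^const>\<open>undefined\<close> outside the dual, so that two
  of them are equal iff they agree on it.\<close>

definition bidual :: "(('a::locally_convex_space \<Rightarrow> real) \<Rightarrow> real) set" where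
  "bidual = {\<phi> \<in> extensional dual.
     (\<forall>f\<in>dual. \<forall>g\<in>dual. \<phi> (\<lambda>x. f x + g x) = \<phi> f + \<phi> g) \<and>
     (\<forall>c. \<forall>f\<in>dual. \<phi> (\<lambda>x. c * f x) = c * \<phi> f) \<and>
     continuous_map dual_topology euclideanreal \<phi>}"

definition bidual_topology :: "(('a::locally_convex_space \<Rightarrow> real) \<Rightarrow> real) topology" where
  "bidual_topology = uniform_topology bidual {K. equicontinuous K}"

definition radon_probs :: "'a topology \<Rightarrow> 'a measure set" where
  "radon_probs X = {\<mu>. sets \<mu> = sigma_sets (topspace X) {U. openin X U} \<and> prob_space \<mu> \<and>
     (\<forall>B\<in>sets \<mu>. measure \<mu> B = (SUP K\<in>{K. compactin X K \<and> K \<subseteq> B}. measure \<mu> K))}"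

text \<open>The weakest topology on \<^term>\<open>radon_probs X\<close> that makes the integrals of all bounded
  continuous functions continuous, given by its canonical subbase.\<close>

definition radon_probs_topology :: "'a topology \<Rightarrow> 'a measure topology" where
  "radon_probs_topology X = topology_generated_by
     {{\<mu> \<in> radon_probs X. (\<integral>x. f x \<partial>\<mu>) \<in> V} | f V.
        continuous_map X euclideanreal f \<and> bounded (f ` topspace X) \<and> open V}"

text \<open>The set \<open>X\<close> carrying \<open>\<mu>\<close> is not an argument: it is \<^term>\<open>space \<mu>\<close>, over which the
  integral is taken.\<close>

definition barycenter :: "'a::locally_convex_space measure \<Rightarrow> ('a \<Rightarrow> real) \<Rightarrow> real" where
  "barycenter \<mu> = (\<lambda>f\<in>dual. \<integral>x. f x \<partial>\<mu>)"

end

theory Submission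
  imports Defs
begin

text \<open>
  Neighborhoods of zero are replaced throughout by continuous seminorms. Minkowski functionals of
  convex symmetric neighborhoods show that every neighborhood of zero contains the unit ball of
  a continuous seminorm (\<open>continuous_seminorm_in_nhd\<close>). Hence \<open>X\<close> is bounded iff every continuous
  seminorm is bounded on \<open>X\<close>, and the equicontinuous sets are exactly the subsets of the polars
  \<open>{f \<in> dual. \<forall>x. \<bar>f x\<bar> \<le> p x}\<close> of continuous seminorms \<open>p\<close>. Continuity of the barycenter map
  therefore means that, for each such \<open>p\<close>, the integrals of the functionals in the polar of \<open>p\<close>
  vary continuously with the measure, uniformly in the functional.

  If \<open>X\<close> is bounded, then \<open>p \<le> C\<close> on \<open>X\<close> for some \<open>C\<close>. By tightness almost all of the mass of \<open>\<mu>\<close>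
  lies on a compact set \<open>Q\<close>, which is covered by finitely many small \<open>p\<close>-balls. A partition of
  unity \<open>\<phi>\<close> on \<open>Q\<close> subordinate to these balls approximates every \<open>f\<close> in the polar, near \<open>Q\<close>, by
  \<open>\<Sum>y\<in>D. f y * \<phi> y x\<close>, while away from \<open>Q\<close> the error is at most \<open>C\<close> times the defect
  \<open>1 - (\<Sum>y\<in>D. \<phi> y x)\<close>. Only the finitely many bounded continuous functions \<open>\<phi> y\<close> occur here, and
  they do not depend on \<open>f\<close>; measures whose integrals of them are close to those of \<open>\<mu>\<close> have uniformly
  close barycenters (\<open>barycenter_equicontinuous_estimate\<close>).

  Conversely, fix \<open>a \<in> X\<close>. The measures \<open>(1 - t) \<delta>\<^sub>a + t \<delta>\<^sub>x\<close> converge to \<open>\<delta>\<^sub>a\<close> as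
  \<open>t\<close> tends to \<open>0\<close>, uniformly in \<open>x \<in> X\<close>, because the test functions are bounded on \<open>X\<close>
  (\<open>two_point_measures_near_dirac\<close>). Continuity of the barycenter map at \<open>\<delta>\<^sub>a\<close> thus yields a
  single \<open>t > 0\<close> with \<open>t * \<bar>f (x - a)\<bar> < 1\<close> for all \<open>x \<in> X\<close> and all \<open>f\<close> in the polar of \<open>p\<close>.
  By the Hahn-Banach theorem some \<open>f\<close> in the polar satisfies \<open>f (x - a) = p (x - a)\<close>, so
  \<open>p (x - a) < 1 / t\<close> on \<open>X\<close>.
\<close>

section \<open>Sublinear functionals and the Hahn-Banach theorem\<close>

text \<open>Positive homogeneity is stated as an inequality: the reverse one follows by scaling back
  (\<open>sublinear_scaleR\<close>), and infima of sublinear functionals inherit inequalities most easily.\<close>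

definition sublinear :: "('a::real_vector \<Rightarrow> real) \<Rightarrow> bool" where
  "sublinear p \<longleftrightarrow> (\<forall>x y. p (x + y) \<le> p x + p y) \<and> (\<forall>c\<ge>0. \<forall>x. p (c *\<^sub>R x) \<le> c * p x)"

lemma sublinear_add: "sublinear p \<Longrightarrow> p (x + y) \<le> p x + p y"
  by (simp add: sublinear_def)

lemma sublinear_zero: "sublinear p \<Longrightarrow> p 0 = 0"
  using sublinear_add[of p 0 0] unfolding sublinear_def
  by (metis add.right_neutral antisym le_add_same_cancel1 mult_zero_left order_refl scaleR_zero_left)

lemma sublinear_scaleR:
  assumes "sublinear p" "0 \<le> c"
  shows "p (c *\<^sub>R x) = c * p x"
proof (cases "c = 0")
  case False
  have "p ((1/c) *\<^sub>R (c *\<^sub>R x)) \<le> (1/c) * p (c *\<^sub>R x)"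
    using assms unfolding sublinear_def by (meson divide_nonneg_nonneg zero_le_one)
  then have "c * p x \<le> p (c *\<^sub>R x)"
    using False assms(2) by (simp add: field_simps)
  then show ?thesis
    using assms unfolding sublinear_def by (meson antisym)
qed (simp add: sublinear_zero[OF assms(1)])

lemma sublinear_ge_minus: "sublinear p \<Longrightarrow> - p (- x) \<le> p x"
  using sublinear_add[of p x "- x"] sublinear_zero[of p] by simp

text \<open>The chain condition is what makes the infimum subadditive: two members \<open>q\<close> and \<open>r\<close>, used to
  estimate the value at \<open>x\<close> and at \<open>y\<close>, can be replaced by the smaller of them. The infima exist
  because \<open>- p (- x) \<le> - q (- x) \<le> q x\<close>.\<close>

lemma sublinear_INF_chain:
  assumes "C \<noteq> {}" "\<And>q. q \<in> C \<Longrightarrow> sublinear q"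
    and total: "\<And>q r. q \<in> C \<Longrightarrow> r \<in> C \<Longrightarrow> q \<le> r \<or> r \<le> q"
    and below: "\<And>q. q \<in> C \<Longrightarrow> q \<le> p"
  shows "sublinear (\<lambda>x. INF q\<in>C. q x)" and "\<And>q. q \<in> C \<Longrightarrow> (\<lambda>x. INF q\<in>C. q x) \<le> q"
proof -
  have bdd: "bdd_below ((\<lambda>q. q x) ` C)" for x
  proof (rule bdd_belowI2)
    fix q assume q: "q \<in> C"
    have "- p (- x) \<le> - q (- x)" using below[OF q] by (simp add: le_fun_def)
    then show "- p (- x) \<le> q x" using sublinear_ge_minus[OF assms(2)[OF q], of x] by linarith
  qed
  show le: "(\<lambda>x. INF q\<in>C. q x) \<le> q" if "q \<in> C" for q
    unfolding le_fun_def by (intro allI cINF_lower bdd that)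
  let ?u = "\<lambda>x. INF q\<in>C. q x"
  have ule: "?u x \<le> q x" if "q \<in> C" for q x
    using le[OF that] by (simp add: le_fun_def)
  show "sublinear ?u"
    unfolding sublinear_def
  proof (intro conjI allI impI)
    fix x y
    have pair: "?u (x + y) \<le> q x + r y" if "q \<in> C" "r \<in> C" for q r
    proof -
      obtain s where s: "s \<in> C" "s \<le> q" "s \<le> r"
        using total[OF \<open>q \<in> C\<close> \<open>r \<in> C\<close>] \<open>q \<in> C\<close> \<open>r \<in> C\<close> by blast
      have "?u (x + y) \<le> s (x + y)" by (rule ule[OF s(1)])
      also have "\<dots> \<le> s x + s y" using assms(2)[OF s(1)] by (rule sublinear_add)
      also have "\<dots> \<le> q x + r y" using s(2,3) by (simp add: le_fun_def add_mono)
      finally show ?thesis .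
    qed
    have "?u (x + y) - q x \<le> ?u y" if "q \<in> C" for q
      using pair[OF that] by (intro cINF_greatest assms(1)) (auto simp: algebra_simps)
    then have "?u (x + y) - ?u y \<le> ?u x"
      by (intro cINF_greatest assms(1)) (auto simp: algebra_simps)
    then show "?u (x + y) \<le> ?u x + ?u y" by simp
  next
    fix c :: real and x assume c: "0 \<le> c"
    have le1: "?u (c *\<^sub>R x) \<le> c * q x" if "q \<in> C" for q
      using ule[OF that, of "c *\<^sub>R x"] sublinear_scaleR[OF assms(2)[OF that] c, of x] by linarith
    show "?u (c *\<^sub>R x) \<le> c * ?u x"
    proof (cases "c = 0")
      case True
      then show ?thesis using le1 assms(1) by auto
    next
      case False
      then have "?u (c *\<^sub>R x) / c \<le> ?u x"
        using le1 c by (intro cINF_greatest assms(1)) (auto simp: field_simps)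
      then show ?thesis using False c by (simp add: field_simps)
    qed
  qed
qed

text \<open>The functional \<open>q x = (INF t\<ge>0. p (x + t *\<^sub>R y) - t * p y)\<close> is the largest sublinear one below \<open>p\<close>
  with \<open>q (- y) \<le> - p y\<close>. This single construction serves twice: applied to a minimal functional it
  forces linearity, and applied to \<open>p\<close> itself it fixes the value at \<open>y\<close> in the Hahn-Banach theorem.\<close>

lemma sublinear_tilt:
  assumes "sublinear p"
  obtains q where "sublinear q" "q \<le> p" "q (- y) \<le> - p y"
proof -
  let ?h = "\<lambda>x t. p (x + t *\<^sub>R y) - t * p y"
  let ?q = "\<lambda>x. INF t\<in>{0..}. ?h x t"
  have bdd: "bdd_below (?h x ` {0..})" for x
  proof (rule bdd_belowI2)
    fix t :: real assume "t \<in> {0..}"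
    then have "t * p y = p ((x + t *\<^sub>R y) + (- x))"
      using sublinear_scaleR[OF assms, of t y] by simp
    also have "\<dots> \<le> p (x + t *\<^sub>R y) + p (- x)" by (rule sublinear_add[OF assms])
    finally show "- p (- x) \<le> ?h x t" by simp
  qed
  have qle: "?q x \<le> ?h x t" if "0 \<le> t" for x t
    using that by (intro cINF_lower bdd) auto
  have "sublinear ?q"
    unfolding sublinear_def
  proof (intro conjI allI impI)
    fix x z
    have pair: "?q (x + z) \<le> ?h x t + ?h z s" if "0 \<le> t" "0 \<le> s" for s t
    proof -
      have "?q (x + z) \<le> ?h (x + z) (t + s)" using that by (intro qle) simp
      also have "\<dots> \<le> ?h x t + ?h z s"
        using sublinear_add[OF assms, of "x + t *\<^sub>R y" "z + s *\<^sub>R y"] by (simp add: algebra_simps)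
      finally show ?thesis .
    qed
    have "?q (x + z) - ?h x t \<le> ?q z" if "0 \<le> t" for t
      using pair[OF that] by (intro cINF_greatest) (auto simp: algebra_simps)
    then have "?q (x + z) - ?q z \<le> ?q x"
      by (intro cINF_greatest) (auto simp: algebra_simps)
    then show "?q (x + z) \<le> ?q x + ?q z" by simp
  next
    fix c :: real and x assume c: "0 \<le> c"
    have le1: "?q (c *\<^sub>R x) \<le> c * ?h x t" if "0 \<le> t" for t
      using qle[of "c * t" "c *\<^sub>R x"] sublinear_scaleR[OF assms c, of "x + t *\<^sub>R y"] c that
      by (simp add: algebra_simps)
    show "?q (c *\<^sub>R x) \<le> c * ?q x"
    proof (cases "c = 0")
      case True
      then show ?thesis using le1[of 0] by auto
    next
      case False
      then have "?q (c *\<^sub>R x) / c \<le> ?q x"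
        using le1 c by (intro cINF_greatest) (auto simp: field_simps)
      then show ?thesis using False c by (simp add: field_simps)
    qed
  qed
  moreover have "?q \<le> p"
    using qle[of 0] by (simp add: le_fun_def)
  moreover have "?q (- y) \<le> - p y"
    using qle[of 1 "- y"] sublinear_zero[OF assms] by simp
  ultimately show ?thesis by (rule that)
qed

lemma linear_if_minimal_sublinear:
  assumes "sublinear m" and minimal: "\<And>q. sublinear q \<Longrightarrow> q \<le> m \<Longrightarrow> q = m"
  shows "linear m"
proof -
  have neg: "m (- y) = - m y" for y
  proof -
    obtain q where "sublinear q" "q \<le> m" "q (- y) \<le> - m y"
      using sublinear_tilt[OF assms(1)] .
    then have "m (- y) \<le> - m y" using minimal by blast
    then show ?thesis using sublinear_ge_minus[OF assms(1), of y] by simp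
  qed
  show ?thesis
  proof (rule linearI)
    fix x y
    have "m x \<le> m (x + y) + m (- y)"
      using sublinear_add[OF assms(1), of "x + y" "- y"] by simp
    then show "m (x + y) = m x + m y"
      using sublinear_add[OF assms(1), of x y] neg[of y] by simp
  next
    fix c :: real and x
    have "m (\<bar>c\<bar> *\<^sub>R x) = \<bar>c\<bar> * m x"
      using sublinear_scaleR[OF assms(1), of "\<bar>c\<bar>" x] by simp
    then show "m (c *\<^sub>R x) = c *\<^sub>R m x"
      using neg[of "c *\<^sub>R x"] by (cases "0 \<le> c") auto
  qed
qed

lemma minimal_sublinear_exists:
  assumes "sublinear p"
  obtains m where "sublinear m" "m \<le> p" "\<And>q. sublinear q \<Longrightarrow> q \<le> m \<Longrightarrow> q = m"
proof -
  let ?A = "{q. sublinear q \<and> q \<le> p}" and ?P = "\<lambda>q r :: 'a \<Rightarrow> real. r \<le> q"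
  have "\<exists>m\<in>?A. \<forall>q\<in>?A. ?P m q \<longrightarrow> q = m"
  proof (rule predicate_Zorn)
    show "partial_order_on ?A (relation_of ?P ?A)"
      by (rule partial_order_on_relation_ofI) auto
    fix C assume C: "C \<in> Chains (relation_of ?P ?A)"
    then have sub: "C \<subseteq> ?A" by (rule Chains_relation_of)
    have total: "q \<le> r \<or> r \<le> q" if "q \<in> C" "r \<in> C" for q r
      using C that unfolding Chains_def relation_of_def by blast
    show "\<exists>u\<in>?A. \<forall>q\<in>C. ?P q u"
    proof (cases "C = {}")
      case True
      then show ?thesis using assms by blast
    next
      case False
      then obtain q where q: "q \<in> C" by blast
      let ?u = "\<lambda>x. INF q\<in>C. q x"
      have u: "sublinear ?u" "\<And>r. r \<in> C \<Longrightarrow> ?u \<le> r"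
        using sublinear_INF_chain[of C p] False sub total by blast+
      have "q \<le> p" using q sub by blast
      with u(2)[OF q] have "?u \<le> p" by (rule order_trans)
      then show ?thesis using u by blast
    qed
  qed
  then obtain m where m: "sublinear m" "m \<le> p" and min: "\<And>q. q \<in> ?A \<Longrightarrow> q \<le> m \<Longrightarrow> q = m"
    by blast
  have "q = m" if "sublinear q" "q \<le> m" for q
    using min[of q] that order_trans[OF that(2) m(2)] by simp
  with m show ?thesis by (rule that)
qed

text \<open>A linear \<open>f\<close> below the tilted functional satisfies \<open>f (- y) \<le> - p y\<close>, that is \<open>p y \<le> f y\<close>.
  Working with minimal sublinear functionals on the whole space avoids functionals defined on
  subspaces only.\<close>

theorem Hahn_Banach_sublinear:
  assumes "sublinear p"
  obtains f where "linear f" "f \<le> p" "f y = p y"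
proof -
  obtain q where q: "sublinear q" "q \<le> p" "q (- y) \<le> - p y"
    using sublinear_tilt[OF assms] .
  obtain f where f: "sublinear f" "f \<le> q" "\<And>r. sublinear r \<Longrightarrow> r \<le> f \<Longrightarrow> r = f"
    using minimal_sublinear_exists[OF q(1)] by blast
  have lin: "linear f" using f(1,3) by (rule linear_if_minimal_sublinear)
  have "f (- y) \<le> - p y" using le_funD[OF f(2)] q(3) by (rule order_trans)
  then have "p y \<le> f y" using linear_neg[OF lin, of y] by simp
  moreover have le: "f \<le> p" using f(2) q(2) by (rule order_trans)
  ultimately have "f y = p y" using le_funD[OF le, of y] by simp
  with lin le show ?thesis by (rule that)
qed

section \<open>Continuous seminorms on a locally convex space\<close>

definition seminorm :: "('a::real_vector \<Rightarrow> real) \<Rightarrow> bool" where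
  "seminorm p \<longleftrightarrow> (\<forall>x y. p (x + y) \<le> p x + p y) \<and> (\<forall>c x. p (c *\<^sub>R x) = \<bar>c\<bar> * p x)"

lemma seminorm_add: "seminorm p \<Longrightarrow> p (x + y) \<le> p x + p y"
  by (simp add: seminorm_def)

lemma seminorm_scaleR: "seminorm p \<Longrightarrow> p (c *\<^sub>R x) = \<bar>c\<bar> * p x"
  by (simp add: seminorm_def)

lemma seminorm_sublinear: "seminorm p \<Longrightarrow> sublinear p"
  by (simp add: seminorm_def sublinear_def)

lemma seminorm_zero: "seminorm p \<Longrightarrow> p 0 = 0"
  using seminorm_scaleR[of p 0 0] by simp

lemma seminorm_minus: "seminorm p \<Longrightarrow> p (- x) = p x"
  using seminorm_scaleR[of p "-1" x] by simp

lemma seminorm_nonneg: "seminorm p \<Longrightarrow> 0 \<le> p x"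
  using sublinear_ge_minus[OF seminorm_sublinear, of p x] seminorm_minus[of p x] by simp

lemma seminorm_diff_le: "seminorm p \<Longrightarrow> \<bar>p x - p y\<bar> \<le> p (x - y)"
  using seminorm_add[of p "x - y" y] seminorm_add[of p "y - x" x] seminorm_minus[of p "x - y"]
  by simp

lemma continuous_on_scaleR_right:
  fixes A :: "'a::locally_convex_space set"
  shows "continuous_on A (\<lambda>x. c *\<^sub>R x)"
proof (rule continuous_at_imp_continuous_on, intro ballI)
  fix x :: 'a
  have "((\<lambda>y. (c, y)) \<longlongrightarrow> (c, x)) (nhds x)"
    by (intro tendsto_Pair tendsto_const filterlim_ident)
  then have "((\<lambda>y. c *\<^sub>R y) \<longlongrightarrow> c *\<^sub>R x) (nhds x)"
    using filterlim_compose[OF tendsto_scaleR_Pair[of c x], of "\<lambda>y. (c, y)"] by (simp add: nhds_prod)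
  then show "isCont (\<lambda>x. c *\<^sub>R x) x"
    unfolding isCont_def by (rule tendsto_mono[OF at_within_le_nhds]) 
qed

lemma continuous_on_scaleR_left:
  fixes x :: "'a::locally_convex_space"
  shows "continuous_on A (\<lambda>c. c *\<^sub>R x)"
proof (rule continuous_at_imp_continuous_on, intro ballI)
  fix c :: real
  have "((\<lambda>d. (d, x)) \<longlongrightarrow> (c, x)) (at c)"
    by (intro tendsto_Pair tendsto_const tendsto_ident_at)
  then show "isCont (\<lambda>c. c *\<^sub>R x) c"
    unfolding isCont_def
    using filterlim_compose[OF tendsto_scaleR_Pair[of c x], of "\<lambda>d. (d, x)"] by (simp add: nhds_prod)
qed

text \<open>Continuity at zero of the dominating seminorm is enough, and only in the weak form that it is
  bounded near zero; so the lemma applies both to a Minkowski functional, before its continuity is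
  known, and to linear functionals.\<close>

lemma continuous_on_if_seminorm_dominated:
  fixes f :: "'a::locally_convex_space \<Rightarrow> real"
  assumes p: "seminorm p" and V: "open V" "0 \<in> V" "\<And>x. x \<in> V \<Longrightarrow> p x \<le> 1"
    and le: "\<And>x y. \<bar>f x - f y\<bar> \<le> p (x - y)"
  shows "continuous_on A f"
proof (rule continuous_at_imp_continuous_on, intro ballI)
  fix x
  show "isCont f x"
    unfolding isCont_def
  proof (rule tendstoI)
    fix e :: real assume e: "0 < e"
    let ?W = "(\<lambda>y. (2 / e) *\<^sub>R (y - x)) -` V"
    have "open ?W"
      by (rule open_vimage[OF V(1)],
          rule continuous_on_compose2[OF continuous_on_scaleR_right[of UNIV]])
        (auto intro!: continuous_intros)
    moreover have "x \<in> ?W" using V(2) by simp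
    moreover have "dist (f y) (f x) < e" if "y \<in> ?W" for y
    proof -
      have "p ((2 / e) *\<^sub>R (y - x)) \<le> 1" using that by (intro V(3)) simp
      then have "p (y - x) \<le> e / 2"
        using e by (simp only: seminorm_scaleR[OF p]) (simp add: field_simps)
      then show ?thesis using le[of y x] e by (simp add: dist_real_def)
    qed
    ultimately show "\<forall>\<^sub>F y in at x. dist (f y) (f x) < e"
      unfolding eventually_at_topological by blast
  qed
qed

definition Minkowski_functional :: "'a::real_vector set \<Rightarrow> 'a \<Rightarrow> real" where
  "Minkowski_functional V x = Inf {t. 0 < t \<and> (1 / t) *\<^sub>R x \<in> V}"

text \<open>The seminorm is the Minkowski functional of the symmetrization of a convex open set inside \<open>U\<close>:
  convexity gives subadditivity, symmetry gives absolute homogeneity, and openness gives continuity.\<close>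

theorem continuous_seminorm_in_nhd:
  fixes U :: "'a::locally_convex_space set"
  assumes "open U" "0 \<in> U"
  obtains p where "seminorm p" "continuous_on UNIV p" "{x. p x < 1} \<subseteq> U"
proof -
  obtain V0 where V0: "convex V0" "open V0" "0 \<in> V0" "V0 \<subseteq> U"
    using convex_neighborhood_base[OF assms] by blast
  define V where "V = V0 \<inter> uminus -` V0"
  have "open (uminus -` V0)" using V0(2) by (rule open_vimage) (intro continuous_intros)
  then have V: "open V" "0 \<in> V" "V \<subseteq> U" using V0 by (auto simp: V_def)
  have sym: "- x \<in> V" if "x \<in> V" for x using that by (auto simp: V_def)
  have conv: "u *\<^sub>R x + v *\<^sub>R y \<in> V" if "x \<in> V" "y \<in> V" "0 \<le> u" "0 \<le> v" "u + v = 1" for x y u v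
  proof -
    have "u *\<^sub>R x + v *\<^sub>R y \<in> V0" "u *\<^sub>R (- x) + v *\<^sub>R (- y) \<in> V0"
      using that V0(1) unfolding convex_def V_def by blast+
    then show ?thesis by (simp add: V_def)
  qed
  let ?S = "\<lambda>x. {t. 0 < t \<and> (1 / t) *\<^sub>R x \<in> V}"
  let ?p = "Minkowski_functional V"
  have bdd: "bdd_below (?S x)" for x by (rule bdd_belowI[of _ 0]) auto
  have le: "?p x \<le> t" if "0 < t" "(1 / t) *\<^sub>R x \<in> V" for x t
    unfolding Minkowski_functional_def using that by (intro cInf_lower bdd) auto
  \<comment> \<open>\<open>V\<close> is absorbing since \<open>c *\<^sub>R x\<close> tends to \<open>0\<close> as \<open>c\<close> does.\<close>
  have ne: "?S x \<noteq> {}" for x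
  proof -
    have "open ((\<lambda>c. c *\<^sub>R x) -` V)" using V(1) continuous_on_scaleR_left by (rule open_vimage)
    moreover have "0 \<in> (\<lambda>c. c *\<^sub>R x) -` V" using V(2) by simp
    ultimately obtain e where e: "0 < e" "ball 0 e \<subseteq> (\<lambda>c. c *\<^sub>R x) -` V"
      by (meson open_contains_ball)
    then have "e / 2 \<in> (\<lambda>c. c *\<^sub>R x) -` V" by (intro subsetD[OF e(2)]) simp
    then have "2 / e \<in> ?S x" using e(1) by simp
    then show ?thesis by blast
  qed
  \<comment> \<open>Since \<open>0 \<in> V\<close>, the set of admissible factors is upward closed.\<close>
  have mem: "(1 / s) *\<^sub>R x \<in> V" if s: "?p x < s" for x s
  proof -
    obtain t where t: "0 < t" "(1 / t) *\<^sub>R x \<in> V" "t < s"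
      using cInf_lessD[OF ne, of x s] s unfolding Minkowski_functional_def by blast
    then have "(t / s) *\<^sub>R ((1 / t) *\<^sub>R x) + (1 - t / s) *\<^sub>R 0 \<in> V"
      using V(2) by (intro conv) auto
    then show ?thesis using t by simp
  qed
  have nonneg: "0 \<le> ?p x" for x
    unfolding Minkowski_functional_def by (rule cInf_greatest[OF ne]) auto
  have "sublinear ?p"
    unfolding sublinear_def
  proof (intro conjI allI impI)
    fix x y
    show "?p (x + y) \<le> ?p x + ?p y"
    proof (rule field_le_epsilon)
      fix e :: real assume e: "0 < e"
      define s t where "s = ?p x + e / 2" and "t = ?p y + e / 2"
      have st: "0 < s" "0 < t" using nonneg[of x] nonneg[of y] e by (auto simp: s_def t_def)
      have "(1 / s) *\<^sub>R x \<in> V" "(1 / t) *\<^sub>R y \<in> V"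
        using e by (intro mem; simp add: s_def t_def)+
      \<comment> \<open>This convex combination equals \<open>(1 / (s + t)) *\<^sub>R (x + y)\<close>.\<close>
      then have "(s / (s + t)) *\<^sub>R ((1 / s) *\<^sub>R x) + (t / (s + t)) *\<^sub>R ((1 / t) *\<^sub>R y) \<in> V"
        using st by (intro conv) (auto simp: add_divide_distrib[symmetric])
      then have "(1 / (s + t)) *\<^sub>R (x + y) \<in> V" using st by (simp add: scaleR_add_right)
      then have "?p (x + y) \<le> s + t" using st by (intro le) auto
      then show "?p (x + y) \<le> ?p x + ?p y + e" by (simp add: s_def t_def)
    qed
  next
    fix c :: real and x assume c: "0 \<le> c"
    show "?p (c *\<^sub>R x) \<le> c * ?p x"
    proof (cases "c = 0")
      case True
      have "?p 0 \<le> 0"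
        by (rule field_le_epsilon) (use le[of _ "0::'a"] V(2) in simp)
      then show ?thesis using True by simp
    next
      case False
      then have c: "0 < c" using c by simp
      have "?p (c *\<^sub>R x) / c \<le> ?p x"
      proof (rule field_le_epsilon)
        fix e :: real assume e: "0 < e"
        let ?s = "?p x + e"
        have s: "0 < ?s" using nonneg[of x] e by simp
        have "(1 / ?s) *\<^sub>R x \<in> V" using e by (intro mem) simp
        then have "(1 / (c * ?s)) *\<^sub>R (c *\<^sub>R x) \<in> V" using c by simp
        then have "?p (c *\<^sub>R x) \<le> c * ?s" using c s by (intro le) auto
        then show "?p (c *\<^sub>R x) / c \<le> ?p x + e" using c by (simp add: field_simps)
      qed
      then show ?thesis using c by (simp add: field_simps)
    qed
  qed
  moreover have minus: "?p (- x) = ?p x" for x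
  proof -
    have "?S (- x) = ?S x" using sym by force
    then show ?thesis by (simp add: Minkowski_functional_def)
  qed
  ultimately have semi: "seminorm ?p"
    unfolding seminorm_def
  proof (intro conjI allI)
    fix c :: real and x
    assume sub: "sublinear ?p"
    show "?p (c *\<^sub>R x) = \<bar>c\<bar> * ?p x"
      using sublinear_scaleR[OF sub, of "\<bar>c\<bar>" x] minus[of "c *\<^sub>R x"] by (cases "0 \<le> c") auto
  qed (rule sublinear_add)
  moreover have "continuous_on UNIV ?p"
    using semi V(1,2) le[of 1] seminorm_diff_le[OF semi]
    by (intro continuous_on_if_seminorm_dominated[of ?p V]) auto
  moreover have "{x. ?p x < 1} \<subseteq> U" using mem[of _ 1] V(3) by auto
  ultimately show ?thesis by (rule that)
qed

lemma absorbs_seminorm_bounded: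
  assumes "seminorm p" "absorbs {x. p x < 1} A"
  shows "\<exists>r. \<forall>x\<in>A. p x \<le> r"
proof -
  obtain r where r: "0 < r" "A \<subseteq> (\<lambda>x. r *\<^sub>R x) ` {x. p x < 1}"
    using assms(2) unfolding absorbs_def by (metis abs_of_pos order_refl)
  have "p x \<le> r" if x: "x \<in> A" for x
  proof -
    obtain y where "x = r *\<^sub>R y" "p y < 1" using r(2) x by blast
    then show ?thesis using r(1) by (simp add: seminorm_scaleR[OF assms(1)] mult_left_le)
  qed
  then show ?thesis by blast
qed

lemma tvs_bounded_iff_seminorms_bounded:
  fixes A :: "'a::locally_convex_space set"
  shows "tvs_bounded A \<longleftrightarrow>
    (\<forall>p. seminorm p \<longrightarrow> continuous_on UNIV p \<longrightarrow> (\<exists>r. \<forall>x\<in>A. p x \<le> r))"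
proof (intro iffI allI impI)
  fix p :: "'a \<Rightarrow> real"
  assume bd: "tvs_bounded A" and p: "seminorm p" "continuous_on UNIV p"
  have "open {x. p x < 1}" using p(2) by (intro open_Collect_less continuous_on_const)
  then have "0 \<in> interior {x. p x < 1}"
    using seminorm_zero[OF p(1)] by (simp add: interior_open)
  then show "\<exists>r. \<forall>x\<in>A. p x \<le> r"
    using bd absorbs_seminorm_bounded[OF p(1)] unfolding tvs_bounded_def by blast
next
  assume *: "\<forall>p. seminorm p \<longrightarrow> continuous_on UNIV p \<longrightarrow> (\<exists>r. \<forall>x\<in>A. p x \<le> r)"
  show "tvs_bounded A"
    unfolding tvs_bounded_def
  proof (intro allI impI)
    fix U :: "'a set" assume "0 \<in> interior U"
    then obtain p where p: "seminorm p" "continuous_on UNIV p" "{x. p x < 1} \<subseteq> interior U"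
      using continuous_seminorm_in_nhd[of "interior U"] by blast
    obtain r where r: "\<And>x. x \<in> A \<Longrightarrow> p x \<le> r" using * p by blast
    have "A \<subseteq> (\<lambda>x. t *\<^sub>R x) ` U" if t: "\<bar>r\<bar> + 1 \<le> \<bar>t\<bar>" for t
    proof
      fix x assume "x \<in> A"
      then have "p x < \<bar>t\<bar>" using r[of x] t by linarith
      then have "p ((1 / t) *\<^sub>R x) < 1" using t by (simp add: seminorm_scaleR[OF p(1)] divide_less_eq)
      then have "(1 / t) *\<^sub>R x \<in> U" using p(3) interior_subset by blast
      moreover have "x = t *\<^sub>R ((1 / t) *\<^sub>R x)" using t by auto
      ultimately show "x \<in> (\<lambda>x. t *\<^sub>R x) ` U" by blast
    qed
    then show "absorbs U A" unfolding absorbs_def by (intro exI[of _ "\<bar>r\<bar> + 1"]) auto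
  qed
qed

section \<open>Equicontinuous sets of functionals and seminorms\<close>

lemma equicontinuous_polar:
  fixes p :: "'a::locally_convex_space \<Rightarrow> real"
  assumes "seminorm p" "continuous_on UNIV p"
  shows "equicontinuous {f \<in> dual. \<forall>x. \<bar>f x\<bar> \<le> p x}"
proof -
  have "open {x. p x < 1}" using assms(2) by (intro open_Collect_less continuous_on_const)
  then have "0 \<in> interior {x. p x < 1}"
    using seminorm_zero[OF assms(1)] by (simp add: interior_open)
  then show ?thesis
    unfolding equicontinuous_def by (intro conjI exI[of _ "{x. p x < 1}"])
      (auto intro: le_less_trans)
qed

lemma equicontinuous_dominated:
  fixes K :: "('a::locally_convex_space \<Rightarrow> real) set"
  assumes "equicontinuous K"
  obtains p where "seminorm p" "continuous_on UNIV p" "\<And>f x. f \<in> K \<Longrightarrow> \<bar>f x\<bar> \<le> p x"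
proof -
  obtain U where U: "K \<subseteq> dual" "0 \<in> interior U" "\<And>x f. x \<in> U \<Longrightarrow> f \<in> K \<Longrightarrow> \<bar>f x\<bar> < 1"
    using assms unfolding equicontinuous_def by blast
  obtain p where p: "seminorm p" "continuous_on UNIV p" "{x. p x < 1} \<subseteq> interior U"
    using continuous_seminorm_in_nhd[OF open_interior U(2)] .
  have "\<bar>f x\<bar> \<le> p x" if f: "f \<in> K" for f x
  proof (rule field_le_epsilon)
    fix e :: real assume "0 < e"
    then have s: "0 < p x + e" using seminorm_nonneg[OF p(1), of x] by linarith
    let ?y = "(1 / (p x + e)) *\<^sub>R x"
    have "p ?y < 1" using s \<open>0 < e\<close> by (simp add: seminorm_scaleR[OF p(1)])
    then have "?y \<in> U" using p(3) interior_subset by blast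
    then have "\<bar>f ?y\<bar> < 1" using U(3) f by blast
    moreover have "linear f" using f U(1) by (auto simp: dual_def)
    ultimately show "\<bar>f x\<bar> \<le> p x + e" using s by (simp add: linear_scale abs_mult divide_less_eq)
  qed
  with p(1,2) show ?thesis by (rule that)
qed

lemma equicontinuous_Union:
  assumes "finite \<B>" "\<And>K. K \<in> \<B> \<Longrightarrow> equicontinuous K"
  shows "equicontinuous (\<Union>\<B>)"
  using assms
proof (induction rule: finite_induct)
  case empty
  then show ?case by (auto simp: equicontinuous_def intro: exI[of _ UNIV])
next
  case (insert K \<B>)
  obtain U where U: "0 \<in> interior U" "\<forall>x\<in>U. \<forall>f\<in>K. \<bar>f x\<bar> < 1" "K \<subseteq> dual"
    using insert.prems[of K] unfolding equicontinuous_def by auto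
  have "equicontinuous (\<Union>\<B>)" using insert by blast
  then obtain W where W: "0 \<in> interior W" "\<forall>x\<in>W. \<forall>f\<in>\<Union>\<B>. \<bar>f x\<bar> < 1" "\<Union>\<B> \<subseteq> dual"
    unfolding equicontinuous_def by auto
  show ?case
    unfolding equicontinuous_def
    by (intro conjI exI[of _ "U \<inter> W"]) (use U W in auto)
qed

text \<open>The polar of \<open>p\<close> contains enough functionals to recover \<open>p\<close>: a linear functional below \<open>p\<close> lies in
  the polar, by symmetry of \<open>p\<close>, and is continuous because \<open>p\<close> is.\<close>

lemma seminorm_attained_on_polar:
  fixes p :: "'a::locally_convex_space \<Rightarrow> real"
  assumes "seminorm p" "continuous_on UNIV p"
  obtains f where "f \<in> dual" "\<And>x. \<bar>f x\<bar> \<le> p x" "f y = p y"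
proof -
  obtain f where f: "linear f" "f \<le> p" "f y = p y"
    using Hahn_Banach_sublinear[OF seminorm_sublinear[OF assms(1)]] by blast
  have le: "\<bar>f x\<bar> \<le> p x" for x
    using le_funD[OF f(2), of x] le_funD[OF f(2), of "- x"] seminorm_minus[OF assms(1), of x]
      linear_neg[OF f(1), of x] by simp
  have "continuous_on UNIV f"
  proof (rule continuous_on_if_seminorm_dominated[OF assms(1)])
    show "open {x. p x < 1}" using assms(2) by (intro open_Collect_less continuous_on_const)
    show "0 \<in> {x. p x < 1}" using seminorm_zero[OF assms(1)] by simp
    show "\<bar>f x - f z\<bar> \<le> p (x - z)" for x z using le[of "x - z"] by (simp add: linear_diff[OF f(1)])
  qed simp
  then have "f \<in> dual" using f(1) by (simp add: dual_def)
  with le f(3) show ?thesis by (intro that)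
qed

section \<open>Radon probability measures\<close>

lemma topspace_radon_probs_topology [simp]:
  "topspace (radon_probs_topology T) = radon_probs T"
proof -
  let ?\<B> = "{{\<mu> \<in> radon_probs T. (\<integral>x. f x \<partial>\<mu>) \<in> V} | f V.
        continuous_map T euclideanreal f \<and> bounded (f ` topspace T) \<and> open V}"
  have "{\<mu> \<in> radon_probs T. (\<integral>x. (0::real) \<partial>\<mu>) \<in> UNIV} \<in> ?\<B>"
    by (rule CollectI, rule exI[of _ "\<lambda>_. 0"], rule exI[of _ UNIV]) (auto simp: image_constant_conv)
  then have "radon_probs T \<in> ?\<B>" by simp
  then have "\<Union>?\<B> = radon_probs T" by blast
  then show ?thesis
    unfolding radon_probs_topology_def by (simp add: topology_generated_by_topspace)
qed

lemma openin_radon_probs_topology_subbasic: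
  assumes "continuous_map T euclideanreal f" "bounded (f ` topspace T)" "open V"
  shows "openin (radon_probs_topology T) {\<mu> \<in> radon_probs T. (\<integral>x. f x \<partial>\<mu>) \<in> V}"
  unfolding radon_probs_topology_def using assms by (intro topology_generated_by_Basis) blast

lemma radon_probs_sets:
  "\<mu> \<in> radon_probs T \<Longrightarrow> sets \<mu> = sets (sigma (topspace T) {U. openin T U})"
  using openin_subset[of T] by (subst sets_measure_of) (auto simp: radon_probs_def)

lemma radon_probs_space: "\<mu> \<in> radon_probs T \<Longrightarrow> space \<mu> = topspace T"
  using sets_eq_imp_space_eq[OF radon_probs_sets] openin_subset[of T]
  by (metis mem_Collect_eq space_measure_of_conv)

lemma radon_probs_prob_space: "\<mu> \<in> radon_probs T \<Longrightarrow> prob_space \<mu>"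
  by (simp add: radon_probs_def)

lemma radon_probs_openin_sets: "\<mu> \<in> radon_probs T \<Longrightarrow> openin T U \<Longrightarrow> U \<in> sets \<mu>"
  by (simp add: radon_probs_def)

lemma radon_probs_measurable:
  assumes "\<mu> \<in> radon_probs T" "continuous_map T euclideanreal f"
  shows "f \<in> borel_measurable \<mu>"
proof (rule borel_measurableI)
  fix S :: "real set" assume "open S"
  then have "openin T {x \<in> topspace T. f x \<in> S}"
    using assms(2) by (simp add: openin_continuous_map_preimage)
  moreover have "f -` S \<inter> space \<mu> = {x \<in> topspace T. f x \<in> S}"
    using radon_probs_space[OF assms(1)] by auto
  ultimately show "f -` S \<inter> space \<mu> \<in> sets \<mu>"
    using radon_probs_openin_sets[OF assms(1)] by simp
qed

lemma radon_probs_integrable: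
  assumes "\<mu> \<in> radon_probs T" "continuous_map T euclideanreal f" "bounded (f ` topspace T)"
  shows "integrable \<mu> f"
proof -
  interpret prob_space \<mu> using radon_probs_prob_space[OF assms(1)] .
  obtain B where "\<And>x. x \<in> topspace T \<Longrightarrow> norm (f x) \<le> B"
    using assms(3) unfolding bounded_iff by auto
  then show ?thesis
    using radon_probs_measurable[OF assms(1,2)] radon_probs_space[OF assms(1)]
    by (intro integrable_const_bound[of f B]) auto
qed

text \<open>Inner regularity applied to the whole space.\<close>

lemma radon_probs_tight:
  assumes \<mu>: "\<mu> \<in> radon_probs T" and e: "0 < e"
  obtains Q where "compactin T Q" "1 - e < measure \<mu> Q"
proof -
  interpret prob_space \<mu> using radon_probs_prob_space[OF \<mu>] .
  let ?Ks = "{K. compactin T K \<and> K \<subseteq> space \<mu>}"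
  have "measure \<mu> (space \<mu>) = (SUP K\<in>?Ks. measure \<mu> K)"
    using \<mu> sets.top[of \<mu>] unfolding radon_probs_def by blast
  then have "1 - e < (SUP K\<in>?Ks. measure \<mu> K)"
    using e prob_space by simp
  moreover have "bdd_above (measure \<mu> ` ?Ks)"
    by (rule bdd_aboveI[of _ 1]) auto
  moreover have "?Ks \<noteq> {}" using compactin_empty by blast
  ultimately obtain Q where "Q \<in> ?Ks" "1 - e < measure \<mu> Q"
    by (subst (asm) less_cSUP_iff) auto
  then show ?thesis using that by blast
qed

section \<open>The barycenter as an element of the bidual\<close>

lemma continuous_map_uniform_topology_euclideanreal:
  assumes "\<And>f e. f \<in> F \<Longrightarrow> 0 < e \<Longrightarrow>
    \<exists>A\<in>\<A>. \<exists>d>0. \<forall>g\<in>uniform_nbhd F f A d. \<bar>\<phi> g - \<phi> f\<bar> < e"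
  shows "continuous_map (uniform_topology F \<A>) euclideanreal \<phi>"
  unfolding continuous_map
proof (intro conjI allI impI)
  fix V :: "real set" assume "openin euclideanreal V"
  then have V: "open V" by simp
  show "openin (uniform_topology F \<A>) {f \<in> topspace (uniform_topology F \<A>). \<phi> f \<in> V}"
    unfolding openin_uniform_topology topspace_uniform_topology
  proof (intro conjI ballI)
    fix f assume f: "f \<in> {f \<in> F. \<phi> f \<in> V}"
    then obtain e where e: "0 < e" "\<And>r. \<bar>r - \<phi> f\<bar> < e \<Longrightarrow> r \<in> V"
      using V unfolding open_dist dist_real_def by blast
    obtain A d where A: "A \<in> \<A>" "0 < d" "\<And>g. g \<in> uniform_nbhd F f A d \<Longrightarrow> \<bar>\<phi> g - \<phi> f\<bar> < e"
      using assms[of f e] f e(1) by blast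
    have "uniform_nbhd F f (\<Union>{A}) d \<subseteq> {f \<in> F. \<phi> f \<in> V}"
      using A(3) e(2) by (auto simp: uniform_nbhd_def)
    then show "\<exists>\<B> e. finite \<B> \<and> \<B> \<subseteq> \<A> \<and> 0 < e \<and>
        uniform_nbhd F f (\<Union>\<B>) e \<subseteq> {f \<in> F. \<phi> f \<in> V}"
      using A(1,2) by (intro exI[of _ "{A}"] exI[of _ d]) simp
  qed auto
qed simp

text \<open>The set \<open>uniform_nbhd F f K e\<close> need not be open, because the supremum over \<open>K\<close> of its members'
  distances to \<open>f\<close> may be equal to \<open>e\<close>. Requiring one \<open>d < e\<close> that bounds all distances leaves
  room for a further perturbation.\<close>

lemma openin_uniform_topology_strict_ball:
  assumes "K \<in> \<A>"
  shows "openin (uniform_topology F \<A>) {g \<in> F. \<exists>d<e. \<forall>k\<in>K. \<bar>g k - f k\<bar> \<le> d}"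
  unfolding openin_uniform_topology
proof (intro conjI ballI)
  let ?O = "{g \<in> F. \<exists>d<e. \<forall>k\<in>K. \<bar>g k - f k\<bar> \<le> d}"
  fix g assume "g \<in> ?O"
  then obtain d where d: "d < e" "\<And>k. k \<in> K \<Longrightarrow> \<bar>g k - f k\<bar> \<le> d" by blast
  have "uniform_nbhd F g (\<Union>{K}) ((e - d) / 2) \<subseteq> ?O"
  proof
    fix h assume h: "h \<in> uniform_nbhd F g (\<Union>{K}) ((e - d) / 2)"
    have "\<bar>h k - f k\<bar> \<le> (e + d) / 2" if "k \<in> K" for k
    proof -
      have "\<bar>h k - g k\<bar> < (e - d) / 2" using h that by (simp add: uniform_nbhd_def)
      then have "\<bar>h k - f k\<bar> \<le> (e - d) / 2 + d"
        using d(2)[OF that] by linarith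
      then show ?thesis by (simp add: field_simps)
    qed
    then show "h \<in> ?O" using h d(1) by (auto simp: uniform_nbhd_def intro!: exI[of _ "(e + d) / 2"])
  qed
  then show "\<exists>\<B> e. finite \<B> \<and> \<B> \<subseteq> \<A> \<and> 0 < e \<and> uniform_nbhd F g (\<Union>\<B>) e \<subseteq> ?O"
    using assms d(1) by (intro exI[of _ "{K}"] exI[of _ "(e - d) / 2"]) simp
qed auto

lemma Hausdorff_space_top_of_set:
  "Hausdorff_space (top_of_set (X :: 'a::t2_space set))"
proof (rule Hausdorff_space_subtopology)
  show "Hausdorff_space (euclidean :: 'a topology)"
    unfolding Hausdorff_space_def disjnt_def using hausdorff by auto
qed

lemma dual_add: "f \<in> dual \<Longrightarrow> g \<in> dual \<Longrightarrow> (\<lambda>x. f x + g x) \<in> dual"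
  by (auto simp: dual_def intro: linear_compose_add continuous_intros)

lemma dual_scale: "f \<in> dual \<Longrightarrow> (\<lambda>x. c * f x) \<in> dual"
  using linear_compose_scale_right[of f c] by (auto simp: dual_def intro: continuous_intros)

lemma dual_linear: "f \<in> dual \<Longrightarrow> linear f"
  by (simp add: dual_def)

lemma dual_continuous_map: "f \<in> dual \<Longrightarrow> continuous_map (top_of_set X) euclideanreal f"
  by (auto simp: dual_def intro: continuous_on_subset)

lemma dual_integrable:
  fixes X :: "'a::locally_convex_space set"
  assumes "weakly_bounded X" "\<mu> \<in> radon_probs (top_of_set X)" "f \<in> dual"
  shows "integrable \<mu> f"
  using assms by (intro radon_probs_integrable[of \<mu> "top_of_set X"] dual_continuous_map)
    (auto simp: weakly_bounded_def)

text \<open>As \<open>X\<close> is weakly bounded, uniform convergence on \<open>X\<close> is controlled by the topology of the dual,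
  and integration against a probability measure on \<open>X\<close> is \<open>1\<close>-Lipschitz for it.\<close>

lemma barycenter_in_bidual:
  fixes X :: "'a::locally_convex_space set"
  assumes X: "weakly_bounded X" and \<mu>: "\<mu> \<in> radon_probs (top_of_set X)"
  shows "barycenter \<mu> \<in> bidual"
proof -
  interpret prob_space \<mu> using radon_probs_prob_space[OF \<mu>] .
  have int: "integrable \<mu> f" if "f \<in> dual" for f
    using X \<mu> that by (rule dual_integrable)
  have "continuous_map dual_topology euclideanreal (barycenter \<mu>)"
    unfolding dual_topology_def
  proof (rule continuous_map_uniform_topology_euclideanreal)
    fix f :: "'a \<Rightarrow> real" and e :: real assume f: "f \<in> dual" and e: "0 < e"
    have "\<bar>barycenter \<mu> g - barycenter \<mu> f\<bar> < e" if g: "g \<in> uniform_nbhd dual f X (e / 2)" for g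
    proof -
      have gd: "g \<in> dual" and less: "\<And>x. x \<in> X \<Longrightarrow> \<bar>g x - f x\<bar> < e / 2"
        using g by (auto simp: uniform_nbhd_def)
      have "barycenter \<mu> g - barycenter \<mu> f = (\<integral>x. g x - f x \<partial>\<mu>)"
        using int[OF f] int[OF gd] f gd by (simp add: barycenter_def)
      also have "\<bar>\<dots>\<bar> \<le> (\<integral>x. \<bar>g x - f x\<bar> \<partial>\<mu>)" by (rule integral_abs_bound)
      also have "\<dots> \<le> e / 2"
        using int[OF f] int[OF gd] less radon_probs_space[OF \<mu>]
        by (intro integral_le_const) (auto intro!: less_imp_le)
      finally show ?thesis using e by simp
    qed
    then show "\<exists>A\<in>{A. weakly_bounded A}. \<exists>d>0. \<forall>g\<in>uniform_nbhd dual f A d.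
        \<bar>barycenter \<mu> g - barycenter \<mu> f\<bar> < e"
      using X e by (intro bexI[of _ X] exI[of _ "e / 2"]) auto
  qed
  then show ?thesis
    unfolding bidual_def using int by (simp add: barycenter_def dual_add dual_scale)
qed

section \<open>Bounded sets have a continuous barycenter map\<close>

text \<open>Truncated tents \<open>h y x\<close> around the points of a finite \<open>r\<close>-net of \<open>Q\<close>, divided by their sum \<open>H x\<close>,
  would form a partition of unity only where \<open>H\<close> does not vanish. Dividing by \<open>max (H x) r\<close> instead
  gives functions that are continuous everywhere, and leaves the quotient unchanged on \<open>Q\<close>, where
  \<open>H > r\<close>. The last conclusion says that \<open>\<phi> y\<close> vanishes outside the \<open>p\<close>-ball of radius \<open>2 * r\<close>
  around \<open>y\<close>.\<close>

lemma partition_on_compact: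
  fixes p :: "'a::locally_convex_space \<Rightarrow> real"
  assumes p: "seminorm p" "continuous_on UNIV p" and Q: "compact Q" and r: "0 < r"
  obtains D \<phi> where "finite D" "D \<subseteq> Q" "\<And>y. continuous_on UNIV (\<phi> y)"
    "\<And>y x. 0 \<le> \<phi> y x" "\<And>x. (\<Sum>y\<in>D. \<phi> y x) \<le> 1" "\<And>x. x \<in> Q \<Longrightarrow> (\<Sum>y\<in>D. \<phi> y x) = 1"
    "\<And>y x. \<phi> y x * p (x - y) \<le> \<phi> y x * (2 * r)"
proof -
  have cont: "continuous_on UNIV (\<lambda>x. p (x - y))" for y
    by (rule continuous_on_compose2[OF p(2)]) (auto intro!: continuous_intros)
  obtain D where D: "finite D" "D \<subseteq> Q" "Q \<subseteq> (\<Union>y\<in>D. {x. p (x - y) < r})"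
  proof (rule compactE_image[OF Q, of Q "\<lambda>y. {x. p (x - y) < r}"])
    show "open {x. p (x - y) < r}" for y using cont by (intro open_Collect_less continuous_on_const)
    show "Q \<subseteq> (\<Union>y\<in>Q. {x. p (x - y) < r})" using seminorm_zero[OF p(1)] r by force
  qed blast
  define h where "h y x = max 0 (2 * r - p (x - y))" for y x
  define H where "H x = (\<Sum>y\<in>D. h y x)" for x
  define \<phi> where "\<phi> y x = h y x / max (H x) r" for y x
  have h: "0 \<le> h y x" for y x by (simp add: h_def)
  have pos: "0 < max (H x) r" for x using r by simp
  have sum: "(\<Sum>y\<in>D. \<phi> y x) = H x / max (H x) r" for x
    by (simp add: \<phi>_def H_def sum_divide_distrib)
  have conth: "continuous_on UNIV (h y)" for y
    unfolding h_def by (intro continuous_intros cont)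
  then have "continuous_on UNIV H"
    unfolding H_def by (intro continuous_intros)
  then have contphi: "continuous_on UNIV (\<phi> y)" for y
    unfolding \<phi>_def using pos by (intro continuous_intros conth) (simp_all add: less_imp_neq[symmetric])
  have ge: "r < H x" if x: "x \<in> Q" for x
  proof -
    obtain y where y: "y \<in> D" "p (x - y) < r" using D(3) x by blast
    then have "r < h y x" by (simp add: h_def)
    also have "\<dots> \<le> H x" unfolding H_def using D(1) y(1) h by (intro member_le_sum) auto
    finally show ?thesis .
  qed
  show ?thesis
  proof (rule that[of D \<phi>, OF D(1,2) contphi])
    show "0 \<le> \<phi> y x" for x y using h pos[of x] by (simp add: \<phi>_def)
    show "(\<Sum>y\<in>D. \<phi> y x) \<le> 1" for x using pos[of x] by (simp add: sum divide_le_eq)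
    show "(\<Sum>y\<in>D. \<phi> y x) = 1" if "x \<in> Q" for x using ge[OF that] r by (simp add: sum)
    show "\<phi> y x * p (x - y) \<le> \<phi> y x * (2 * r)" for y x
    proof (cases "p (x - y) \<le> 2 * r")
      case True
      then show ?thesis using h pos[of x] by (intro mult_left_mono) (simp_all add: \<phi>_def)
    qed (simp add: \<phi>_def h_def)
  qed
qed

text \<open>Write \<open>f x - (\<Sum>y\<in>D. f y * \<phi> y x)\<close> as \<open>(\<Sum>y\<in>D. \<phi> y x * f (x - y)) + f x * (1 - (\<Sum>y\<in>D. \<phi> y x))\<close>.
  In the first sum only points \<open>y\<close> at \<open>p\<close>-distance at most \<open>2 * r\<close> from \<open>x\<close> contribute.\<close>

lemma partition_approximation:
  fixes p :: "'a::locally_convex_space \<Rightarrow> real"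
  assumes f: "linear f" "\<And>x. \<bar>f x\<bar> \<le> p x" and C: "p x \<le> C"
    and nonneg: "\<And>y. 0 \<le> \<phi> y x" and le1: "(\<Sum>y\<in>D. \<phi> y x) \<le> 1"
    and near: "\<And>y. \<phi> y x * p (x - y) \<le> \<phi> y x * (2 * r)" and r: "0 < r"
  shows "\<bar>f x - (\<Sum>y\<in>D. f y * \<phi> y x)\<bar> \<le> 2 * r + C * (1 - (\<Sum>y\<in>D. \<phi> y x))"
proof -
  let ?s = "\<Sum>y\<in>D. \<phi> y x"
  have "f x - (\<Sum>y\<in>D. f y * \<phi> y x) = (\<Sum>y\<in>D. \<phi> y x * f (x - y)) + f x * (1 - ?s)"
    by (simp add: linear_diff[OF f(1)] algebra_simps sum_subtractf sum_distrib_left sum_distrib_right)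
  also have "\<bar>\<dots>\<bar> \<le> \<bar>\<Sum>y\<in>D. \<phi> y x * f (x - y)\<bar> + \<bar>f x * (1 - ?s)\<bar>" by (rule abs_triangle_ineq)
  also have "\<bar>\<Sum>y\<in>D. \<phi> y x * f (x - y)\<bar> \<le> (\<Sum>y\<in>D. \<phi> y x * (2 * r))"
  proof (rule sum_abs[THEN order_trans], rule sum_mono)
    fix y
    have "\<bar>\<phi> y x * f (x - y)\<bar> \<le> \<phi> y x * p (x - y)"
      using nonneg[of y] f(2)[of "x - y"] by (simp add: abs_mult mult_left_mono)
    then show "\<bar>\<phi> y x * f (x - y)\<bar> \<le> \<phi> y x * (2 * r)" using near[of y] by (rule order_trans)
  qed
  also have "(\<Sum>y\<in>D. \<phi> y x * (2 * r)) = ?s * (2 * r)" by (rule sum_distrib_right[symmetric])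
  also have "\<dots> \<le> 2 * r" using mult_right_mono[OF le1, of "2 * r"] r by simp
  also have "\<bar>f x * (1 - ?s)\<bar> \<le> C * (1 - ?s)"
    using f(2)[of x] C le1 by (auto simp: abs_mult intro!: mult_right_mono)
  finally show ?thesis by simp
qed

text \<open>The neighborhood \<open>W\<close> depends on \<open>p\<close>, \<open>\<mu>\<close> and \<open>e\<close> but not on \<open>f\<close>: it constrains only the integrals
  of the functions of a partition of unity.\<close>

lemma barycenter_equicontinuous_estimate:
  fixes X :: "'a::locally_convex_space set"
  assumes p: "seminorm p" "continuous_on UNIV p" and bd: "\<And>x. x \<in> X \<Longrightarrow> p x \<le> C"
    and \<mu>: "\<mu> \<in> radon_probs (top_of_set X)" and e: "0 < e"
  obtains W where "openin (radon_probs_topology (top_of_set X)) W" "\<mu> \<in> W"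
    "\<And>\<nu> f. \<nu> \<in> W \<Longrightarrow> f \<in> dual \<Longrightarrow> (\<And>x. \<bar>f x\<bar> \<le> p x) \<Longrightarrow> \<bar>(\<integral>x. f x \<partial>\<nu>) - (\<integral>x. f x \<partial>\<mu>)\<bar> \<le> e"
proof -
  let ?T = "top_of_set X"
  interpret M: prob_space \<mu> using radon_probs_prob_space[OF \<mu>] .
  have "X \<noteq> {}" using M.not_empty radon_probs_space[OF \<mu>] by auto
  then have C: "0 \<le> C" using bd seminorm_nonneg[OF p(1)] by (meson equals0I order_trans)
  \<comment> \<open>The total error at the end is \<open>(2 * r + C * r) + C * r + (2 * r + 2 * C * r) = 4 * (1 + C) * r\<close>.\<close>
  define r where "r = e / (4 * (1 + C))"
  have r: "0 < r" using e C by (simp add: r_def)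
  obtain Q where Q: "compactin ?T Q" "1 - r < measure \<mu> Q"
    using radon_probs_tight[OF \<mu> r] .
  then have cQ: "compact Q" "Q \<subseteq> X" by (auto simp: compactin_subtopology)
  obtain D \<phi> where D: "finite D" "D \<subseteq> Q" and cont: "\<And>y. continuous_on UNIV (\<phi> y)"
    and nonneg: "\<And>y x. 0 \<le> \<phi> y x" and le1: "\<And>x. (\<Sum>y\<in>D. \<phi> y x) \<le> 1"
    and one: "\<And>x. x \<in> Q \<Longrightarrow> (\<Sum>y\<in>D. \<phi> y x) = 1"
    and near: "\<And>y x. \<phi> y x * p (x - y) \<le> \<phi> y x * (2 * r)"
    using partition_on_compact[OF p cQ(1) r] by metis
  have \<phi>_map: "continuous_map ?T euclideanreal (\<phi> y)" for y
    using cont by (auto intro: continuous_on_subset)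
  have \<phi>_bdd: "bounded (\<phi> y ` topspace ?T)" if "y \<in> D" for y
  proof -
    have "\<phi> y x \<le> 1" for x
      using member_le_sum[OF that, of "\<lambda>y. \<phi> y x"] nonneg D(1) le1[of x] by (meson order_trans)
    then show ?thesis using nonneg by (auto simp: bounded_iff intro!: exI[of _ 1])
  qed
  \<comment> \<open>Adding \<open>1\<close> keeps \<open>s\<close> positive when \<open>D\<close> is empty.\<close>
  define s where "s = r / (card D + 1)"
  have s: "0 < s" "card D * s \<le> r" using r by (auto simp: s_def field_simps)
  \<comment> \<open>Intersecting with \<open>radon_probs ?T\<close> makes \<open>W\<close> the whole space, not \<open>UNIV\<close>, for empty \<open>D\<close>.\<close>
  define W where "W = radon_probs ?T \<inter>
    (\<Inter>y\<in>D. {\<nu> \<in> radon_probs ?T. (\<integral>x. \<phi> y x \<partial>\<nu>) \<in> ball (\<integral>x. \<phi> y x \<partial>\<mu>) s})"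
  have op: "openin (radon_probs_topology ?T) W"
  proof (cases "D = {}")
    case True
    then show ?thesis
      unfolding W_def using openin_topspace[of "radon_probs_topology ?T"] by simp
  next
    case False
    have "openin (radon_probs_topology ?T)
      (\<Inter>y\<in>D. {\<nu> \<in> radon_probs ?T. (\<integral>x. \<phi> y x \<partial>\<nu>) \<in> ball (\<integral>x. \<phi> y x \<partial>\<mu>) s})"
      using D(1) False \<phi>_map \<phi>_bdd
      by (intro openin_INT2 openin_radon_probs_topology_subbasic) auto
    then show ?thesis
      unfolding W_def using openin_topspace[of "radon_probs_topology ?T"] by (intro openin_Int) simp
  qed
  have mem: "\<mu> \<in> W" using \<mu> s(1) by (simp add: W_def)
  have close: "\<bar>(\<integral>x. \<phi> y x \<partial>\<nu>) - (\<integral>x. \<phi> y x \<partial>\<mu>)\<bar> \<le> s" if "\<nu> \<in> W" "y \<in> D" for \<nu> y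
    using that by (force simp: W_def dist_real_def)
  have approx: "\<bar>(\<integral>x. f x \<partial>\<nu>) - (\<Sum>y\<in>D. f y * (\<integral>x. \<phi> y x \<partial>\<nu>))\<bar> \<le>
      2 * r + C * (1 - (\<Sum>y\<in>D. \<integral>x. \<phi> y x \<partial>\<nu>))"
    if \<nu>: "\<nu> \<in> radon_probs ?T" and f: "f \<in> dual" "\<And>x. \<bar>f x\<bar> \<le> p x" for \<nu> f
  proof -
    interpret N: prob_space \<nu> using radon_probs_prob_space[OF \<nu>] .
    have "bounded (f ` topspace ?T)"
      using f(2) bd by (auto simp: bounded_iff intro!: exI[of _ C] intro: order_trans)
    then have intf: "integrable \<nu> f"
      using radon_probs_integrable[OF \<nu> dual_continuous_map[OF f(1)]] by blast
    have int\<phi>: "integrable \<nu> (\<phi> y)" if "y \<in> D" for y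
      using radon_probs_integrable[OF \<nu> \<phi>_map \<phi>_bdd[OF that]] .
    let ?g = "\<lambda>x. f x - (\<Sum>y\<in>D. f y * \<phi> y x)" and ?b = "\<lambda>x. 2 * r + C * (1 - (\<Sum>y\<in>D. \<phi> y x))"
    have intg: "integrable \<nu> ?g" and intb: "integrable \<nu> ?b"
      using intf int\<phi> by auto
    have "(\<integral>x. f x \<partial>\<nu>) - (\<Sum>y\<in>D. f y * (\<integral>x. \<phi> y x \<partial>\<nu>)) = (\<integral>x. ?g x \<partial>\<nu>)"
      using intf int\<phi> by simp
    also have "\<bar>\<dots>\<bar> \<le> (\<integral>x. \<bar>?g x\<bar> \<partial>\<nu>)" by (rule integral_abs_bound)
    also have "\<dots> \<le> (\<integral>x. ?b x \<partial>\<nu>)"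
    proof (rule integral_mono)
      fix x assume "x \<in> space \<nu>"
      then have "p x \<le> C" using bd radon_probs_space[OF \<nu>] by simp
      then show "\<bar>?g x\<bar> \<le> ?b x"
        by (intro partition_approximation[OF dual_linear[OF f(1)] f(2) _ nonneg le1 near r])
    qed (use intg intb in auto)
    also have "\<dots> = 2 * r + C * (1 - (\<Sum>y\<in>D. \<integral>x. \<phi> y x \<partial>\<nu>))"
      using int\<phi> by (simp add: N.prob_space)
    finally show ?thesis .
  qed
  have int\<phi>: "integrable \<mu> (\<phi> y)" if "y \<in> D" for y
    using radon_probs_integrable[OF \<mu> \<phi>_map \<phi>_bdd[OF that]] .
  \<comment> \<open>The sum of the \<open>\<phi> y\<close> dominates the indicator of \<open>Q\<close>.\<close>
  have mass: "1 - r \<le> (\<Sum>y\<in>D. \<integral>x. \<phi> y x \<partial>\<mu>)"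
  proof -
    have Qs: "Q \<in> sets \<mu>"
    proof -
      have "closedin ?T Q" using Q(1) by (intro compactin_imp_closedin Hausdorff_space_top_of_set)
      then have "openin ?T (topspace ?T - Q)" by blast
      then have "space \<mu> - (X - Q) \<in> sets \<mu>"
        using radon_probs_openin_sets[OF \<mu>] by (intro sets.compl_sets) simp
      then show ?thesis using cQ(2) radon_probs_space[OF \<mu>] by (simp add: double_diff)
    qed
    have "measure \<mu> Q = (\<integral>x. indicator Q x \<partial>\<mu>)" using Qs by simp
    also have "\<dots> \<le> (\<integral>x. (\<Sum>y\<in>D. \<phi> y x) \<partial>\<mu>)"
    proof (rule integral_mono)
      show "integrable \<mu> (indicator Q :: 'a \<Rightarrow> real)"
        using Qs by (simp add: M.emeasure_finite less_top[symmetric])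
      show "indicator Q x \<le> (\<Sum>y\<in>D. \<phi> y x)" for x
        using one[of x] nonneg by (simp add: indicator_def sum_nonneg)
    qed (use int\<phi> in auto)
    also have "\<dots> = (\<Sum>y\<in>D. \<integral>x. \<phi> y x \<partial>\<mu>)" using int\<phi> by simp
    finally show ?thesis using Q(2) by simp
  qed
  have "\<bar>(\<integral>x. f x \<partial>\<nu>) - (\<integral>x. f x \<partial>\<mu>)\<bar> \<le> e"
    if \<nu>: "\<nu> \<in> W" and f: "f \<in> dual" "\<And>x. \<bar>f x\<bar> \<le> p x" for \<nu> f
  proof -
    let ?S = "\<lambda>\<nu>. \<Sum>y\<in>D. \<integral>x. \<phi> y x \<partial>\<nu>" and ?F = "\<lambda>\<nu>. \<Sum>y\<in>D. f y * (\<integral>x. \<phi> y x \<partial>\<nu>)"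
    have \<nu>': "\<nu> \<in> radon_probs ?T" using \<nu> by (simp add: W_def)
    have "\<bar>?S \<nu> - ?S \<mu>\<bar> = \<bar>\<Sum>y\<in>D. (\<integral>x. \<phi> y x \<partial>\<nu>) - (\<integral>x. \<phi> y x \<partial>\<mu>)\<bar>"
      by (simp add: sum_subtractf)
    also have "\<dots> \<le> (\<Sum>y\<in>D. s)"
      by (rule sum_abs[THEN order_trans], rule sum_mono, rule close[OF \<nu>])
    finally have S: "\<bar>?S \<nu> - ?S \<mu>\<bar> \<le> r" using s(2) by simp
    have "\<bar>?F \<nu> - ?F \<mu>\<bar> = \<bar>\<Sum>y\<in>D. f y * ((\<integral>x. \<phi> y x \<partial>\<nu>) - (\<integral>x. \<phi> y x \<partial>\<mu>))\<bar>"
      by (simp add: sum_subtractf right_diff_distrib)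
    also have "\<dots> \<le> (\<Sum>y\<in>D. C * s)"
    proof (rule sum_abs[THEN order_trans], rule sum_mono)
      fix y assume y: "y \<in> D"
      then have "\<bar>f y\<bar> \<le> C" using f(2)[of y] bd[of y] D(2) cQ(2) by (meson order_trans subsetD)
      then show "\<bar>f y * ((\<integral>x. \<phi> y x \<partial>\<nu>) - (\<integral>x. \<phi> y x \<partial>\<mu>))\<bar> \<le> C * s"
        unfolding abs_mult using close[OF \<nu> y] C by (intro mult_mono) auto
    qed
    also have "\<dots> = C * (card D * s)" by simp
    also have "\<dots> \<le> C * r" using s(2) C by (rule mult_left_mono)
    finally have F: "\<bar>?F \<nu> - ?F \<mu>\<bar> \<le> C * r" .
    have "C * (1 - ?S \<mu>) \<le> C * r" using mass C by (intro mult_left_mono) auto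
    then have A\<mu>: "\<bar>(\<integral>x. f x \<partial>\<mu>) - ?F \<mu>\<bar> \<le> 2 * r + C * r"
      using approx[OF \<mu> f] by linarith
    have "C * (1 - ?S \<nu>) \<le> C * (2 * r)" using mass S C by (intro mult_left_mono) auto
    then have A\<nu>: "\<bar>(\<integral>x. f x \<partial>\<nu>) - ?F \<nu>\<bar> \<le> 2 * r + 2 * (C * r)"
      using approx[OF \<nu>' f] by (simp add: mult.left_commute)
    have "r * (4 * (1 + C)) = e" using C by (simp add: r_def)
    then have "4 * r + 4 * (C * r) = e" by (simp add: algebra_simps)
    then show ?thesis using F A\<mu> A\<nu> by linarith
  qed
  with op mem show ?thesis by (rule that)
qed

text \<open>A basic neighborhood in the bidual is given by finitely many equicontinuous sets. Their union is
  equicontinuous, hence dominated by one continuous seminorm, which is bounded on \<open>X\<close>.\<close>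

theorem continuous_barycenter_if_bounded:
  fixes X :: "'a::locally_convex_space set"
  assumes X: "tvs_bounded X" "weakly_bounded X"
  shows "continuous_map (radon_probs_topology (top_of_set X)) bidual_topology barycenter"
  unfolding continuous_map
proof (intro conjI allI impI)
  let ?T = "radon_probs_topology (top_of_set X)"
  show "barycenter ` topspace ?T \<subseteq> topspace bidual_topology"
    using barycenter_in_bidual[OF X(2)] by (auto simp: bidual_topology_def)
  fix O' :: "(('a \<Rightarrow> real) \<Rightarrow> real) set" assume O': "openin bidual_topology O'"
  show "openin ?T {\<mu> \<in> topspace ?T. barycenter \<mu> \<in> O'}"
  proof (subst openin_subopen, intro ballI)
    fix \<mu> assume "\<mu> \<in> {\<mu> \<in> topspace ?T. barycenter \<mu> \<in> O'}"
    then have \<mu>: "\<mu> \<in> radon_probs (top_of_set X)" "barycenter \<mu> \<in> O'" by auto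
    obtain \<B> e where \<B>: "finite \<B>" "\<B> \<subseteq> {K. equicontinuous K}" "0 < e"
      and sub: "uniform_nbhd bidual (barycenter \<mu>) (\<Union>\<B>) e \<subseteq> O'"
      using O' \<mu>(2) unfolding bidual_topology_def openin_uniform_topology by blast
    have eq: "equicontinuous (\<Union>\<B>)" using \<B>(1,2) by (intro equicontinuous_Union) auto
    obtain p where p: "seminorm p" "continuous_on UNIV p" "\<And>f x. f \<in> \<Union>\<B> \<Longrightarrow> \<bar>f x\<bar> \<le> p x"
      using equicontinuous_dominated[OF eq] by blast
    obtain C where "\<And>x. x \<in> X \<Longrightarrow> p x \<le> C"
      using X(1) p(1,2) unfolding tvs_bounded_iff_seminorms_bounded by blast
    then obtain W where W: "openin ?T W" "\<mu> \<in> W"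
      "\<And>\<nu> f. \<nu> \<in> W \<Longrightarrow> f \<in> dual \<Longrightarrow> (\<And>x. \<bar>f x\<bar> \<le> p x) \<Longrightarrow>
        \<bar>(\<integral>x. f x \<partial>\<nu>) - (\<integral>x. f x \<partial>\<mu>)\<bar> \<le> e / 2"
      using barycenter_equicontinuous_estimate[OF p(1,2) _ \<mu>(1), of C "e / 2"] \<B>(3) by auto
    have "W \<subseteq> {\<mu> \<in> topspace ?T. barycenter \<mu> \<in> O'}"
    proof
      fix \<nu> assume \<nu>: "\<nu> \<in> W"
      then have \<nu>': "\<nu> \<in> radon_probs (top_of_set X)" using openin_subset[OF W(1)] by auto
      have "\<bar>barycenter \<nu> f - barycenter \<mu> f\<bar> < e" if f: "f \<in> \<Union>\<B>" for f
      proof -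
        have d: "f \<in> dual" using f eq by (auto simp: equicontinuous_def)
        have "\<bar>(\<integral>x. f x \<partial>\<nu>) - (\<integral>x. f x \<partial>\<mu>)\<bar> \<le> e / 2" using W(3)[OF \<nu> d p(3)[OF f]] .
        then show ?thesis using d \<B>(3) by (simp add: barycenter_def)
      qed
      then have "barycenter \<nu> \<in> O'"
        using barycenter_in_bidual[OF X(2) \<nu>']
        by (intro subsetD[OF sub]) (auto simp: uniform_nbhd_def)
      then show "\<nu> \<in> {\<mu> \<in> topspace ?T. barycenter \<mu> \<in> O'}" using \<nu>' by simp
    qed
    then show "\<exists>W. openin ?T W \<and> \<mu> \<in> W \<and> W \<subseteq> {\<mu> \<in> topspace ?T. barycenter \<mu> \<in> O'}"
      using W(1,2) by blast
  qed
qed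

section \<open>A continuous barycenter map forces boundedness\<close>

text \<open>The measure \<open>(1 - t) \<delta>\<^sub>a + t \<delta>\<^sub>b\<close>, realized as the image of a Bernoulli distribution.\<close>

definition two_point_measure :: "'a topology \<Rightarrow> 'a \<Rightarrow> 'a \<Rightarrow> real \<Rightarrow> 'a measure" where
  "two_point_measure T a b t =
     distr (measure_pmf (bernoulli_pmf t)) (sigma (topspace T) {U. openin T U})
       (\<lambda>h. if h then b else a)"

text \<open>Inner regularity is immediate: the part \<open>B \<inter> {a, b}\<close> of a set \<open>B\<close> is compact and carries all the
  mass of \<open>B\<close>. The separation axiom \<open>t1_space\<close> makes finite sets measurable.\<close>

lemma
  assumes "a \<in> topspace T" "b \<in> topspace T" "0 \<le> t" "t \<le> 1" "t1_space T"
  shows two_point_measure_radon: "two_point_measure T a b t \<in> radon_probs T"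
    and two_point_measure_integral: "\<And>f :: 'a \<Rightarrow> real. continuous_map T euclideanreal f \<Longrightarrow>
      (\<integral>x. f x \<partial>two_point_measure T a b t) = (1 - t) * f a + t * f b"
proof -
  let ?S = "sigma (topspace T) {U. openin T U}" and ?M = "two_point_measure T a b t"
  let ?g = "\<lambda>h. if h then b else a"
  have sub: "{U. openin T U} \<subseteq> Pow (topspace T)" using openin_subset by blast
  have meas: "?g \<in> measurable (measure_pmf (bernoulli_pmf t)) ?S"
    using assms(1,2) sub by (simp add: space_measure_of)
  have sets: "sets ?M = sigma_sets (topspace T) {U. openin T U}"
    using sub by (simp add: two_point_measure_def)
  have prob: "prob_space ?M"
    unfolding two_point_measure_def by (intro measure_pmf.prob_space_distr meas)
  then interpret M: prob_space ?M .
  show radon: "?M \<in> radon_probs T"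
    unfolding radon_probs_def
  proof (intro CollectI conjI sets prob ballI)
    fix B assume B: "B \<in> sets ?M"
    let ?K = "B \<inter> {a, b}"
    have K: "compactin T ?K"
      using assms(1,2) by (intro finite_imp_compactin) auto
    have pts: "{a, b} \<in> sets ?M"
    proof -
      have "closedin T {a, b}" using assms by (simp add: t1_space_closedin_finite)
      then have "openin T (topspace T - {a, b})" by blast
      then have "topspace T - (topspace T - {a, b}) \<in> sets ?M"
        unfolding sets by (intro sigma_sets.Compl sigma_sets.Basic) simp
      moreover have "topspace T - (topspace T - {a, b}) = {a, b}" using assms(1,2) by blast
      ultimately show ?thesis by simp
    qed
    have "measure ?M ?K = measure ?M B"
      unfolding two_point_measure_def
      using B pts by (subst (1 2) measure_distr[OF meas])
        (auto simp: two_point_measure_def intro!: arg_cong[where f = "measure _"])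
    moreover have "measure ?M K \<le> measure ?M B" if "K \<subseteq> B" for K
      using that B by (rule M.finite_measure_mono)
    ultimately show "measure ?M B = (SUP K\<in>{K. compactin T K \<and> K \<subseteq> B}. measure ?M K)"
    proof (intro cSup_eq_maximum[symmetric])
      show "measure ?M B \<in> measure ?M ` {K. compactin T K \<and> K \<subseteq> B}"
        using K \<open>measure ?M ?K = measure ?M B\<close> by (intro image_eqI[of _ _ ?K]) auto
    qed blast
  qed
  fix f :: "'a \<Rightarrow> real" assume f: "continuous_map T euclideanreal f"
  have "f \<in> borel_measurable ?M" by (rule radon_probs_measurable[OF radon f])
  then have "f \<in> borel_measurable ?S" by (simp add: two_point_measure_def)
  then have "(\<integral>x. f x \<partial>?M) = (\<integral>h. f (?g h) \<partial>measure_pmf (bernoulli_pmf t))"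
    unfolding two_point_measure_def by (rule integral_distr[OF meas])
  also have "\<dots> = (1 - t) * f a + t * f b" using assms(3,4) by simp
  finally show "(\<integral>x. f x \<partial>?M) = (1 - t) * f a + t * f b" .
qed

text \<open>The point is that \<open>t\<close> does not depend on \<open>b\<close>. For a subbasic set this holds because the integrals of
  a test function \<open>f\<close> against the two measures differ by \<open>t * (f b - f a)\<close> and \<open>f\<close> is bounded; the
  property passes to finite intersections and arbitrary unions.\<close>

lemma two_point_measures_near_dirac:
  assumes "openin (radon_probs_topology T) W" "two_point_measure T a a 0 \<in> W"
    and a: "a \<in> topspace T" and T1: "t1_space T"
  obtains t where "0 < t" "t \<le> 1" "\<And>b. b \<in> topspace T \<Longrightarrow> two_point_measure T a b t \<in> W"
proof -
  have "\<exists>d>0. \<forall>t b. 0 \<le> t \<longrightarrow> t \<le> d \<longrightarrow> t \<le> 1 \<longrightarrow> b \<in> topspace T \<longrightarrow> two_point_measure T a b t \<in> W"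
    using assms(1,2) unfolding radon_probs_topology_def openin_topology_generated_by_iff
  proof (induction W rule: generate_topology_on.induct)
    case (Int U V)
    obtain d where d: "d > 0"
      "\<forall>t b. 0 \<le> t \<longrightarrow> t \<le> d \<longrightarrow> t \<le> 1 \<longrightarrow> b \<in> topspace T \<longrightarrow> two_point_measure T a b t \<in> U"
      using Int.IH(1) Int.prems by blast
    obtain e where e: "e > 0"
      "\<forall>t b. 0 \<le> t \<longrightarrow> t \<le> e \<longrightarrow> t \<le> 1 \<longrightarrow> b \<in> topspace T \<longrightarrow> two_point_measure T a b t \<in> V"
      using Int.IH(2) Int.prems by blast
    show ?case by (intro exI[of _ "min d e"]) (use d e in simp)
  next
    case (UN \<K>)
    then obtain U where "U \<in> \<K>" "two_point_measure T a a 0 \<in> U" by blast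
    then show ?case using UN.IH[of U] by blast
  next
    case (Basis S)
    then obtain f V where f: "continuous_map T euclideanreal f" "bounded (f ` topspace T)"
      and V: "open V" and S: "S = {\<mu> \<in> radon_probs T. (\<integral>x. f x \<partial>\<mu>) \<in> V}"
      by blast
    have "f a \<in> V"
      using Basis.prems two_point_measure_integral[OF a a _ _ T1 f(1), of 0] by (simp add: S)
    then obtain e where e: "0 < e" "\<And>r. \<bar>r - f a\<bar> < e \<Longrightarrow> r \<in> V"
      using V unfolding open_dist dist_real_def by blast
    obtain C where C: "0 < C" "\<And>x. x \<in> topspace T \<Longrightarrow> \<bar>f x\<bar> \<le> C"
      using f(2) unfolding bounded_pos by auto
    have "two_point_measure T a b t \<in> S"
      if t: "0 \<le> t" "t \<le> e / (4 * C)" "t \<le> 1" and b: "b \<in> topspace T" for t b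
    proof -
      have "\<bar>f b - f a\<bar> \<le> 2 * C" using C(2)[OF a] C(2)[OF b] by linarith
      then have "t * \<bar>f b - f a\<bar> \<le> e / (4 * C) * (2 * C)"
        using t e(1) C(1) by (intro mult_mono) auto
      also have "\<dots> < e" using e(1) C(1) by simp
      finally have "\<bar>t * (f b - f a)\<bar> < e" using t(1) by (simp add: abs_mult)
      moreover have "((1 - t) * f a + t * f b) - f a = t * (f b - f a)" by (simp add: algebra_simps)
      ultimately have "(1 - t) * f a + t * f b \<in> V" using e(2) by metis
      then show ?thesis
        using two_point_measure_integral[OF a b t(1,3) T1 f(1)]
          two_point_measure_radon[OF a b t(1,3) T1] by (simp add: S)
    qed
    then show ?case using e(1) C(1) by (intro exI[of _ "e / (4 * C)"]) simp
  qed simp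
  then obtain d where d: "0 < d" "\<And>t b. 0 \<le> t \<Longrightarrow> t \<le> d \<Longrightarrow> t \<le> 1 \<Longrightarrow> b \<in> topspace T \<Longrightarrow>
      two_point_measure T a b t \<in> W"
    by blast
  show ?thesis by (rule that[of "min d 1"]) (use d in auto)
qed

text \<open>If \<open>X\<close> were unbounded, moving a small fixed portion of the mass of a Dirac measure to a remote point
  of \<open>X\<close> would move the barycenter arbitrarily far, although the measure itself stays close.\<close>

theorem bounded_if_continuous_barycenter:
  fixes X :: "'a::locally_convex_space set"
  assumes cont: "continuous_map (radon_probs_topology (top_of_set X)) bidual_topology barycenter"
  shows "tvs_bounded X"
  unfolding tvs_bounded_iff_seminorms_bounded
proof (intro allI impI)
  fix p :: "'a \<Rightarrow> real" assume p: "seminorm p" "continuous_on UNIV p"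
  let ?T = "top_of_set X" and ?K = "{f \<in> dual. \<forall>x. \<bar>f x\<bar> \<le> p x}"
  show "\<exists>r. \<forall>x\<in>X. p x \<le> r"
  proof (cases "X = {}")
    case False
    then obtain a where a: "a \<in> topspace ?T" by auto
    have T1: "t1_space ?T"
      by (intro Hausdorff_imp_t1_space Hausdorff_space_top_of_set)
    let ?m = "two_point_measure ?T a"
    define N where "N = {g \<in> bidual. \<exists>d<1. \<forall>k\<in>?K. \<bar>g k - barycenter (?m a 0) k\<bar> \<le> d}"
    have rad: "?m b t \<in> radon_probs ?T" if "b \<in> X" "0 \<le> t" "t \<le> 1" for b t
      using a that T1 by (intro two_point_measure_radon) auto
    have bary: "barycenter (?m b t) f = (1 - t) * f a + t * f b"
      if "b \<in> X" "0 \<le> t" "t \<le> 1" "f \<in> dual" for b t f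
      using a that T1 dual_continuous_map[OF that(4), of X]
      by (simp add: barycenter_def two_point_measure_integral)
    have "openin bidual_topology N"
      unfolding bidual_topology_def N_def using equicontinuous_polar[OF p]
      by (intro openin_uniform_topology_strict_ball) simp
    then have op: "openin (radon_probs_topology ?T) {\<mu> \<in> radon_probs ?T. barycenter \<mu> \<in> N}"
      using openin_continuous_map_preimage[OF cont] by simp
    have "?m a 0 \<in> radon_probs ?T" using rad[of a 0] a by simp
    moreover have "barycenter ` radon_probs ?T \<subseteq> bidual"
      using continuous_map_image_subset_topspace[OF cont] by (simp add: bidual_topology_def)
    moreover have "\<exists>d<1. \<forall>k\<in>?K. \<bar>barycenter (?m a 0) k - barycenter (?m a 0) k\<bar> \<le> d"
      by (rule exI[of _ 0]) simp
    ultimately have mem: "?m a 0 \<in> {\<mu> \<in> radon_probs ?T. barycenter \<mu> \<in> N}"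
      unfolding N_def by blast
    obtain t where t: "0 < t" "t \<le> 1"
      "\<And>b. b \<in> topspace ?T \<Longrightarrow> ?m b t \<in> {\<mu> \<in> radon_probs ?T. barycenter \<mu> \<in> N}"
      using two_point_measures_near_dirac[OF op mem a T1] by blast
    \<comment> \<open>The functional norming \<open>x - a\<close> turns the closeness of the barycenters into a bound on \<open>p (x - a)\<close>.\<close>
    have "p x \<le> 1 / t + p a" if x: "x \<in> X" for x
    proof -
      obtain f where f: "f \<in> dual" "\<And>x. \<bar>f x\<bar> \<le> p x" "f (x - a) = p (x - a)"
        using seminorm_attained_on_polar[OF p, of "x - a"] by blast
      have "barycenter (?m x t) \<in> N" using t(3)[of x] x by simp
      then obtain d where d: "d < 1"
        "\<And>k. k \<in> ?K \<Longrightarrow> \<bar>barycenter (?m x t) k - barycenter (?m a 0) k\<bar> \<le> d"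
        unfolding N_def by blast
      have "f \<in> ?K" using f(1,2) by blast
      from d(2)[OF this] d(1) have "\<bar>barycenter (?m x t) f - barycenter (?m a 0) f\<bar> < 1"
        by (rule le_less_trans)
      moreover have "barycenter (?m x t) f - barycenter (?m a 0) f = t * f (x - a)"
        using bary[OF x _ t(2) f(1)] bary[of a 0 f] a t(1) f(1)
        by (simp add: linear_diff[OF dual_linear[OF f(1)]] algebra_simps)
      ultimately have "t * p (x - a) < 1" using f(3) by simp
      then have "p (x - a) < 1 / t" using t(1) by (simp add: field_simps)
      then show ?thesis using seminorm_add[OF p(1), of "x - a" a] by simp
    qed
    then show ?thesis by blast
  qed simp
qed

theorem theorem3p2:
  fixes X :: "'a::locally_convex_space set"
  assumes "weakly_bounded X"
  shows "continuous_map (radon_probs_topology (top_of_set X)) bidual_topology barycenter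
           \<longleftrightarrow> tvs_bounded X"
  using bounded_if_continuous_barycenter continuous_barycenter_if_bounded assms by blast

end
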